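(* Let $n,m\ge 0$ be integers and let $0\le a\le 1$. Suppose that $n<m$. Then the linearization coefficient $\beta_k^{(n,m)}(a)$ of the Bessel polynomials is positive for $n\le k<m$.
   Context: Pochhammer symbol: $(z)_0=1$, $(z)_r=z(z+1)\cdots(z+r-1)$ for integer $r\ge 1$. For an integer $n\ge 0$ the Bessel polynomial of degree $n$ (normalized by $q_n(0)=1$) is $$q_n(u)=\sum_{k=0}^n\frac{(-n)_k\,2^k}{(-2n)_k\,k!}\,u^k .$$ The linearization coefficients $\beta_k^{(n,m)}(a)$ are defined by the expansion $$q_n(au)\,q_m((1-a)u)=\sum_{k=0}^{n+m}\beta_k^{(n,m)}(a)\,q_k(u),$$ which is unique since $q_k$ has degree $k$ for each $k$.
   Formalization: Strict positivity fails at the endpoints (for n=0, m=1, k=0 the coefficient equals a, which is 0 at a=0); the formal theorem states that the coefficient is nonnegative for 0≤a≤1 and strictly positive for 0<a<1. *)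

theory Defs
  imports Complex_Main "HOL-Computational_Algebra.Polynomial"
begin

definition bessel_poly :: "nat \<Rightarrow> real poly" where
  "bessel_poly n =
     (\<Sum>k\<le>n. monom (pochhammer (- real n) k * 2 ^ k / (pochhammer (- 2 * real n) k * fact k)) k)"

(* The coefficient sequence is made total by setting it to 0 beyond n + m, so that the
   description is unique; lemma bessel_linearization_ex1 below justifies the definite description. *)
definition is_bessel_linearization :: "nat \<Rightarrow> nat \<Rightarrow> real \<Rightarrow> (nat \<Rightarrow> real) \<Rightarrow> bool" where
  "is_bessel_linearization n m a b \<longleftrightarrow>
     (\<forall>k>n + m. b k = 0) \<and>
     pcompose (bessel_poly n) [:0, a:] * pcompose (bessel_poly m) [:0, 1 - a:] =
       (\<Sum>k\<le>n + m. smult (b k) (bessel_poly k))"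

definition bessel_lin_coeff :: "nat \<Rightarrow> nat \<Rightarrow> real \<Rightarrow> nat \<Rightarrow> real" where
  "bessel_lin_coeff n m a = (THE b. is_bessel_linearization n m a b)"

lemma coeff_bessel_poly:
  "coeff (bessel_poly n) k =
     (if k \<le> n then pochhammer (- real n) k * 2 ^ k / (pochhammer (- 2 * real n) k * fact k) else 0)"
  by (auto simp: bessel_poly_def coeff_sum if_distrib cong: if_cong)

lemma coeff_bessel_poly_top: "coeff (bessel_poly n) n \<noteq> 0"
proof -
  have "pochhammer (- real n) n \<noteq> 0"
    by (auto simp: pochhammer_eq_0_iff)
  moreover have "pochhammer (- 2 * real n) n \<noteq> 0"
  proof
    assume "pochhammer (- 2 * real n) n = 0"
    then obtain j where "j < n" "- 2 * real n = - real j"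
      by (auto simp: pochhammer_eq_0_iff)
    then show False by linarith
  qed
  ultimately show ?thesis unfolding coeff_bessel_poly by simp
qed

lemma degree_bessel_poly: "degree (bessel_poly n) = n"
proof (rule antisym)
  show "degree (bessel_poly n) \<le> n"
    by (rule degree_le) (simp add: coeff_bessel_poly)
  show "n \<le> degree (bessel_poly n)"
    by (rule le_degree[OF coeff_bessel_poly_top])
qed

lemma bessel_poly_0: "poly (bessel_poly n) 0 = 1"
  by (simp add: poly_0_coeff_0 coeff_bessel_poly)

lemma bessel_expansion_exists:
  "degree p \<le> N \<Longrightarrow> \<exists>b. (\<forall>k>N. b k = 0) \<and> p = (\<Sum>k\<le>N. smult (b k) (bessel_poly k))"
proof (induction N arbitrary: p)
  case 0
  then obtain c where c: "p = [:c:]" by (auto elim: degree_eq_zeroE)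
  have "bessel_poly 0 = 1" by (simp add: bessel_poly_def one_pCons monom_0)
  with c show ?case by (intro exI[of _ "\<lambda>k. if k = 0 then c else 0"]) auto
next
  case (Suc N)
  define c where "c = coeff p (Suc N) / coeff (bessel_poly (Suc N)) (Suc N)"
  define r where "r = p - smult c (bessel_poly (Suc N))"
  have "degree r \<le> N"
  proof (rule degree_le, intro allI impI)
    fix i assume "N < i"
    then consider "i = Suc N" | "i > Suc N" by linarith
    then show "coeff r i = 0"
    proof cases
      case 1 then show ?thesis by (simp add: r_def c_def coeff_bessel_poly_top)
    next
      case 2
      then have "coeff p i = 0" using Suc.prems by (simp add: coeff_eq_0)
      with 2 show ?thesis by (simp add: r_def coeff_bessel_poly)
    qed
  qed
  from Suc.IH[OF this] obtain b where b: "\<forall>k>N. b k = 0"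
    "r = (\<Sum>k\<le>N. smult (b k) (bessel_poly k))" by blast
  have "(\<Sum>k\<le>N. smult ((b(Suc N := c)) k) (bessel_poly k)) = r"
    unfolding b(2) by (rule sum.cong) auto
  then have "p = (\<Sum>k\<le>Suc N. smult ((b(Suc N := c)) k) (bessel_poly k))"
    by (simp add: r_def)
  then show ?case using b(1) by (intro exI[of _ "b(Suc N := c)"]) auto
qed

lemma bessel_poly_independent:
  "(\<Sum>k\<le>N. smult (c k) (bessel_poly k)) = 0 \<Longrightarrow> k \<le> N \<Longrightarrow> c k = 0"
proof (induction N arbitrary: k)
  case 0
  then show ?case using coeff_bessel_poly_top[of 0] by auto
next
  case (Suc N)
  have "coeff (\<Sum>k\<le>Suc N. smult (c k) (bessel_poly k)) (Suc N)
      = c (Suc N) * coeff (bessel_poly (Suc N)) (Suc N)"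
    by (simp add: coeff_sum coeff_bessel_poly)
  then have "c (Suc N) = 0"
    unfolding Suc.prems(1) using coeff_bessel_poly_top[of "Suc N"] by simp
  with Suc show ?case by (cases "k = Suc N") auto
qed

lemma bessel_linearization_ex1: "\<exists>!b. is_bessel_linearization n m a b"
proof -
  let ?p = "pcompose (bessel_poly n) [:0, a:] * pcompose (bessel_poly m) [:0, 1 - a:]"
  have "degree (pcompose (bessel_poly l) [:0, x:]) \<le> l" for l x
    by (rule order.trans[OF degree_pcompose_le]) (simp add: degree_bessel_poly)
  then have "degree ?p \<le> n + m"
    by (meson add_mono degree_mult_le order.trans)
  from bessel_expansion_exists[OF this] obtain b where b: "is_bessel_linearization n m a b"
    by (auto simp: is_bessel_linearization_def)
  moreover have "b' = b" if b': "is_bessel_linearization n m a b'" for b'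
  proof
    fix k
    have "(\<Sum>k\<le>n + m. smult (b' k - b k) (bessel_poly k)) = 0"
      using b b' by (simp add: is_bessel_linearization_def smult_diff_left sum_subtractf)
    then have "k \<le> n + m \<Longrightarrow> b' k - b k = 0" by (rule bessel_poly_independent)
    then show "b' k = b k"
      using b b' by (cases "k \<le> n + m") (auto simp: is_bessel_linearization_def)
  qed
  ultimately show ?thesis by blast
qed

lemma bessel_lin_coeff_expansion:
  "pcompose (bessel_poly n) [:0, a:] * pcompose (bessel_poly m) [:0, 1 - a:] =
     (\<Sum>k\<le>n + m. smult (bessel_lin_coeff n m a k) (bessel_poly k))"
  using theI'[OF bessel_linearization_ex1[of n m a]]
  by (simp add: bessel_lin_coeff_def is_bessel_linearization_def)

end

theory Submission
  imports Defs
begin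

text \<open>
  Write \<open>q\<^sub>k\<close> for the Bessel polynomials. The functions \<open>e\<^sup>-\<^sup>u q\<^sub>k(u)\<close> differentiate into each other up
  to a factor \<open>u\<close>: \<open>(e\<^sup>-\<^sup>u q\<^sub>k\<^sub>+\<^sub>1)' = - u e\<^sup>-\<^sup>u q\<^sub>k / (2k+1)\<close>. Since
  \<open>e\<^sup>-\<^sup>u q\<^sub>n(au) q\<^sub>m((1-a)u)\<close> is the product of \<open>e\<^sup>-\<^sup>a\<^sup>u q\<^sub>n(au)\<close> and \<open>e\<^sup>-\<^sup>(\<^sup>1\<^sup>-\<^sup>a\<^sup>)\<^sup>u q\<^sub>m((1-a)u)\<close>, differentiating
  the linearization identity and comparing coefficients gives a recursion that expresses
  \<open>\<beta>\<^sub>k\<^sub>+\<^sub>1\<close> for \<open>(n+1, m+1)\<close> as a combination of \<open>\<beta>\<^sub>k\<close> for \<open>(n, m+1)\<close> and for \<open>(n+1, m)\<close> with the nonnegative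
  weights \<open>(2k+1) a\<^sup>2/(2n+1)\<close> and \<open>(2k+1) (1-a)\<^sup>2/(2m+1)\<close> (lemma \<open>bessel_lin_coeff_Suc_Suc_Suc\<close>).

  Iterating, \<open>\<beta>\<^sub>k = 0\<close> for \<open>k < min n m\<close>, and for \<open>n \<le> k < m\<close> positivity reduces to the case \<open>n = 0\<close>,
  that is, to the connection coefficients in \<open>q\<^sub>m((1-a)u) = \<Sum> \<gamma>\<^sub>k q\<^sub>k(u)\<close>. Differentiating there
  leaves an additional term \<open>a q\<^sub>m((1-a)u)\<close>, because the first factor is the bare exponential
  \<open>e\<^sup>-\<^sup>a\<^sup>u\<close>. That term is harmless because, for \<open>m > 0\<close>,
  \<open>(q\<^sub>m(u) - 1)/u\<close> is a combination of \<open>q\<^sub>0, \<dots>, q\<^sub>m\<^sub>-\<^sub>1\<close> with nonnegative coefficients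
  (lemma \<open>bessel_poly_Suc_minus_one_nonneg_expansion\<close>); a second identity,
  \<open>q\<^sub>k\<^sub>+\<^sub>2 = q\<^sub>k\<^sub>+\<^sub>1 + u\<^sup>2 q\<^sub>k / ((2k+1)(2k+3))\<close>, yields a recursion for these coefficients. Thus the
  \<open>\<gamma>\<^sub>k\<close> obey a recursion with nonnegative weights as well.
\<close>

section \<open>Differential and three-term relations\<close>

lemma coeff_bessel_poly_Suc:
  assumes "k \<le> n"
  shows "coeff (bessel_poly n) (Suc k) * ((2 * real n - real k) * (real k + 1)) =
         coeff (bessel_poly n) k * (2 * (real n - real k))"
proof (cases "k = n")
  case True
  then show ?thesis by (simp add: coeff_bessel_poly)
next
  case False
  with assms have k: "k < n" by simp
  have "pochhammer (- 2 * real n) k \<noteq> 0"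
  proof
    assume "pochhammer (- 2 * real n) k = 0"
    then obtain j where "j < k" "- 2 * real n = - real j"
      by (auto simp: pochhammer_eq_0_iff)
    with k show False by linarith
  qed
  moreover have "- 2 * real n + real k \<noteq> 0" using k by linarith
  ultimately show ?thesis using k
    by (simp add: coeff_bessel_poly pochhammer_Suc divide_simps) (simp add: algebra_simps)
qed

lemma coeff_bessel_poly_Suc_Suc:
  assumes "k \<le> n"
  shows "coeff (bessel_poly (Suc n)) (Suc k) =
         coeff (bessel_poly n) k * (2 * real n + 1 - real k) / ((2 * real n + 1) * (real k + 1))"
  using assms
proof (induction k)
  case 0
  then show ?case by (simp add: coeff_bessel_poly divide_simps)
next
  case (Suc k)
  define c where "c = coeff (bessel_poly n) k"
  have k: "real k + 1 \<le> real n" using Suc.prems by linarith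
  then have nz: "2 * real n + 1 - real k \<noteq> 0" "2 * real n - real k \<noteq> 0" "real k + 1 \<noteq> 0"
    "real k + 2 \<noteq> 0" "2 * real n + 1 \<noteq> 0" by linarith+
  have IH: "coeff (bessel_poly (Suc n)) (Suc k) =
      c * (2 * real n + 1 - real k) / ((2 * real n + 1) * (real k + 1))"
    using Suc by (simp add: c_def)
  have "coeff (bessel_poly n) (Suc k) * ((2 * real n - real k) * (real k + 1)) = c * (2 * (real n - real k))"
    using Suc.prems unfolding c_def by (intro coeff_bessel_poly_Suc) simp
  then have 1: "coeff (bessel_poly n) (Suc k) = c * (2 * (real n - real k)) / ((2 * real n - real k) * (real k + 1))"
    using nz by (simp add: eq_divide_eq)
  have "coeff (bessel_poly (Suc n)) (Suc (Suc k)) * ((2 * real n + 1 - real k) * (real k + 2)) =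
      coeff (bessel_poly (Suc n)) (Suc k) * (2 * (real n - real k))"
    using coeff_bessel_poly_Suc[of "Suc k" "Suc n"] Suc.prems by (simp add: algebra_simps)
  then have 2: "coeff (bessel_poly (Suc n)) (Suc (Suc k)) =
      coeff (bessel_poly (Suc n)) (Suc k) * (2 * (real n - real k)) / ((2 * real n + 1 - real k) * (real k + 2))"
    using nz by (simp add: eq_divide_eq)
  have r: "2 * real n + 1 - real (Suc k) = 2 * real n - real k" "real (Suc k) + 1 = real k + 2" by simp_all
  show ?case unfolding 2 1 IH r using nz by (simp add: divide_simps)
qed

text \<open>
  Conjugating \<open>- d/du\<close> by multiplication with \<open>e\<^sup>-\<^sup>u\<close> gives this operator; in this form the
  differentiations of \<open>e\<^sup>-\<^sup>u p(u)\<close> can be carried out inside the ring of polynomials.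
\<close>
definition exp_deriv :: "real poly \<Rightarrow> real poly" where
  "exp_deriv p = p - pderiv p"

lemma exp_deriv_add: "exp_deriv (p + q) = exp_deriv p + exp_deriv q"
  by (simp add: exp_deriv_def pderiv_add)

lemma exp_deriv_smult: "exp_deriv (smult c p) = smult c (exp_deriv p)"
  by (simp add: exp_deriv_def pderiv_smult smult_diff_right)

lemma exp_deriv_sum: "exp_deriv (\<Sum>x\<in>A. f x) = (\<Sum>x\<in>A. exp_deriv (f x))"
  by (induction A rule: infinite_finite_induct) (simp_all add: exp_deriv_add, simp_all add: exp_deriv_def)

text \<open>
  The kernel would consist of multiples of \<open>e\<^sup>u\<close>, and no such nonzero function is a polynomial. Hence
  polynomial identities may be checked after applying the operator, with no constant of integration
  to determine.
\<close>
lemma exp_deriv_inject: "exp_deriv p = exp_deriv q \<longleftrightarrow> p = q"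
proof
  assume "exp_deriv p = exp_deriv q"
  then have *: "pderiv (p - q) = p - q" by (simp add: exp_deriv_def pderiv_diff algebra_simps)
  then have "degree (p - q) = degree (p - q) - 1" using degree_pderiv[of "p - q"] by simp
  then have "pderiv (p - q) = 0" by (simp add: pderiv_eq_0_iff)
  with * show "p = q" by simp
qed simp

text \<open>
  The product rule for \<open>e\<^sup>-\<^sup>a\<^sup>u p(au)\<close> times \<open>e\<^sup>-\<^sup>(\<^sup>1\<^sup>-\<^sup>a\<^sup>)\<^sup>u q((1-a)u)\<close>; the scalings matter only in that they
  add up to 1.
\<close>
lemma exp_deriv_scaled_mult:
  "exp_deriv (pcompose p [:0, a:] * pcompose q [:0, 1 - a:]) =
     smult a (pcompose (exp_deriv p) [:0, a:]) * pcompose q [:0, 1 - a:] +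
     pcompose p [:0, a:] * smult (1 - a) (pcompose (exp_deriv q) [:0, 1 - a:])"
  by (simp add: exp_deriv_def pderiv_mult pderiv_pcompose pcompose_diff pderiv_pCons
      smult_diff_right smult_diff_left algebra_simps)

lemma bessel_poly_zero: "bessel_poly 0 = 1"
  by (simp add: bessel_poly_def one_pCons monom_0)

lemma exp_deriv_bessel_poly_0: "exp_deriv (bessel_poly 0) = 1"
  by (simp add: bessel_poly_zero exp_deriv_def)

lemma exp_deriv_bessel_poly_Suc:
  "exp_deriv (bessel_poly (Suc n)) = smult (1 / (2 * real n + 1)) ([:0, 1:] * bessel_poly n)"
proof (rule poly_eqI)
  fix i
  show "coeff (exp_deriv (bessel_poly (Suc n))) i =
      coeff (smult (1 / (2 * real n + 1)) ([:0, 1:] * bessel_poly n)) i"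
  proof (cases i)
    case 0
    then show ?thesis by (simp add: exp_deriv_def coeff_pderiv coeff_bessel_poly divide_simps)
  next
    case (Suc k)
    show ?thesis
    proof (cases "k \<le> n")
      case False
      then show ?thesis using Suc by (simp add: exp_deriv_def coeff_pderiv coeff_bessel_poly)
    next
      case True
      define A where "A = coeff (bessel_poly (Suc n)) (Suc k)"
      define B where "B = coeff (bessel_poly (Suc n)) (Suc (Suc k))"
      have nz: "2 * real n + 1 - real k \<noteq> 0" "real k + 1 \<noteq> 0" "2 * real n + 1 \<noteq> 0"
        using True by linarith+
      have "B * ((2 * real n + 1 - real k) * (real k + 2)) = A * (2 * (real n - real k))"
        using coeff_bessel_poly_Suc[of "Suc k" "Suc n"] True
        by (simp add: A_def B_def algebra_simps)
      then have B: "B * (real k + 2) = A * (2 * (real n - real k)) / (2 * real n + 1 - real k)"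
        using nz by (simp add: eq_divide_eq algebra_simps)
      have A: "A = coeff (bessel_poly n) k * (2 * real n + 1 - real k) / ((2 * real n + 1) * (real k + 1))"
        unfolding A_def using True by (rule coeff_bessel_poly_Suc_Suc)
      have "A - B * (real k + 2) = A * (real k + 1) / (2 * real n + 1 - real k)"
        unfolding B using nz(1) by (simp add: divide_simps) (simp add: algebra_simps)
      also have "\<dots> = coeff (bessel_poly n) k / (2 * real n + 1)"
        unfolding A using nz by simp
      finally show ?thesis using Suc
        by (simp add: exp_deriv_def coeff_pderiv A_def B_def algebra_simps)
    qed
  qed
qed

text \<open>
  For positive index this is the three-term recurrence
  \<open>q\<^sub>k\<^sub>+\<^sub>2 = q\<^sub>k\<^sub>+\<^sub>1 + u\<^sup>2 q\<^sub>k / ((2k+1)(2k+3))\<close>; stating it through the operator includes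
  \<open>q\<^sub>1 = q\<^sub>0 + u\<close> as the index 0 case.
\<close>
lemma X_mult_exp_deriv_bessel_poly:
  "[:0, 1:] * exp_deriv (bessel_poly j) =
     smult (2 * real j + 1) (bessel_poly (Suc j) - bessel_poly j)"
proof (cases j)
  case 0
  have "bessel_poly 1 = [:1, 1:]"
    by (simp add: bessel_poly_def one_pCons monom_0 monom_Suc)
  then show ?thesis unfolding 0 exp_deriv_bessel_poly_0 by (simp add: bessel_poly_zero one_pCons)
next
  case (Suc n)
  have "[:0, 1:] * smult (1 / (2 * real n + 1)) ([:0, 1:] * bessel_poly n) =
     smult (2 * real n + 3) (bessel_poly (Suc (Suc n)) - bessel_poly (Suc n))"
  proof (rule poly_eqI)
    fix i
    consider "i = 0" | "i = 1" | k where "i = Suc (Suc k)" by (metis One_nat_def not0_implies_Suc)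
    then show "coeff ([:0, 1:] * smult (1 / (2 * real n + 1)) ([:0, 1:] * bessel_poly n)) i =
       coeff (smult (2 * real n + 3) (bessel_poly (Suc (Suc n)) - bessel_poly (Suc n))) i"
    proof cases
      case 1
      then show ?thesis by (simp add: coeff_bessel_poly)
    next
      case 2
      have "coeff (bessel_poly (Suc j)) 1 = 1" for j
        by (simp add: coeff_bessel_poly divide_simps)
      then show ?thesis using 2 by simp
    next
      case (3 k)
      show ?thesis
      proof (cases "k \<le> n")
        case False
        then show ?thesis using 3 by (simp add: coeff_bessel_poly)
      next
        case True
        define c where "c = coeff (bessel_poly n) k"
        define A where "A = coeff (bessel_poly (Suc n)) (Suc k)"
        define B where "B = coeff (bessel_poly (Suc n)) (Suc (Suc k))"
        define C where "C = coeff (bessel_poly (Suc (Suc n))) (Suc (Suc k))"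
        have nz: "2 * real n + 1 - real k \<noteq> 0" "real k + 1 \<noteq> 0" "real k + 2 \<noteq> 0"
          "2 * real n + 1 \<noteq> 0" "2 * real n + 3 \<noteq> 0"
          using True by linarith+
        have "B * ((2 * real n + 1 - real k) * (real k + 2)) = A * (2 * (real n - real k))"
          using coeff_bessel_poly_Suc[of "Suc k" "Suc n"] True
          by (simp add: A_def B_def algebra_simps)
        then have B: "B = A * (2 * (real n - real k)) / ((2 * real n + 1 - real k) * (real k + 2))"
          using nz by (simp add: eq_divide_eq)
        have A: "A = c * (2 * real n + 1 - real k) / ((2 * real n + 1) * (real k + 1))"
          unfolding A_def c_def using True by (rule coeff_bessel_poly_Suc_Suc)
        have C: "C = A * (2 * real n + 2 - real k) / ((2 * real n + 3) * (real k + 2))"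
          using coeff_bessel_poly_Suc_Suc[of "Suc k" "Suc n"] True
          by (simp add: C_def A_def algebra_simps)
        have C': "(2 * real n + 3) * C = A * (2 * real n + 2 - real k) / (real k + 2)"
          unfolding C using nz by simp
        have num: "(2 * real n + 2 - real k) * (2 * real n + 1 - real k) -
            (2 * real n + 3) * (2 * (real n - real k)) = (real k + 1) * (real k + 2)"
          by (simp add: algebra_simps)
        have "(2 * real n + 3) * (C - B) =
            A * ((2 * real n + 2 - real k) * (2 * real n + 1 - real k) -
              (2 * real n + 3) * (2 * (real n - real k))) / ((2 * real n + 1 - real k) * (real k + 2))"
          unfolding right_diff_distrib C' B using nz
          by (simp add: divide_simps) (simp add: algebra_simps)
        also have "\<dots> = A * (real k + 1) / (2 * real n + 1 - real k)"
          unfolding num using nz by simp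
        also have "\<dots> = c / (2 * real n + 1)"
          unfolding A using nz by simp
        finally show ?thesis using 3
          by (simp add: B_def C_def c_def)
      qed
    qed
  qed
  then show ?thesis using Suc by (simp add: exp_deriv_bessel_poly_Suc add.commute)
qed

lemma smult_sum_right: "smult c (\<Sum>x\<in>A. f x) = (\<Sum>x\<in>A. smult c (f x))"
  by (induction A rule: infinite_finite_induct) (simp_all add: smult_add_right)

lemma exp_deriv_bessel_sum:
  "exp_deriv (\<Sum>k\<le>Suc N. smult (b k) (bessel_poly k)) =
     [:b 0:] + [:0, 1:] * (\<Sum>k\<le>N. smult (b (Suc k) / (2 * real k + 1)) (bessel_poly k))"
  by (simp only: sum.atMost_Suc_shift exp_deriv_add exp_deriv_sum exp_deriv_smult
      exp_deriv_bessel_poly_0 exp_deriv_bessel_poly_Suc sum_distrib_left)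
     (simp add: one_pCons)

section \<open>Recursion for the linearization coefficients\<close>

lemma bessel_lin_coeff_eq_0: "n + m < k \<Longrightarrow> bessel_lin_coeff n m a k = 0"
  using theI'[OF bessel_linearization_ex1[of n m a]]
  by (simp add: bessel_lin_coeff_def is_bessel_linearization_def)

lemma bessel_lin_coeff_expansion_le:
  assumes "n + m \<le> N"
  shows "pcompose (bessel_poly n) [:0, a:] * pcompose (bessel_poly m) [:0, 1 - a:] =
     (\<Sum>k\<le>N. smult (bessel_lin_coeff n m a k) (bessel_poly k))"
  unfolding bessel_lin_coeff_expansion
  by (rule sum.mono_neutral_left) (use assms in \<open>auto simp: bessel_lin_coeff_eq_0\<close>)

lemma bessel_lin_coeff_eqI:
  assumes "\<And>k. n + m < k \<Longrightarrow> b k = 0"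
    and "pcompose (bessel_poly n) [:0, a:] * pcompose (bessel_poly m) [:0, 1 - a:] =
       (\<Sum>k\<le>n + m. smult (b k) (bessel_poly k))"
  shows "bessel_lin_coeff n m a = b"
  unfolding bessel_lin_coeff_def
  by (rule the1_equality[OF bessel_linearization_ex1])
     (use assms in \<open>simp add: is_bessel_linearization_def\<close>)

text \<open>
  The operator sends \<open>q\<^sub>0\<close> to 1 and \<open>q\<^sub>k\<^sub>+\<^sub>1\<close> to a multiple of \<open>u q\<^sub>k\<close>, so the linearization coefficients
  can be read off from the image of the product, the index dropping by one.
\<close>
lemma bessel_lin_coeff_by_exp_deriv:
  assumes "n + m = Suc N"
    and zero: "\<And>k. N < k \<Longrightarrow> d k = 0"
    and eq: "exp_deriv (pcompose (bessel_poly n) [:0, a:] * pcompose (bessel_poly m) [:0, 1 - a:]) =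
       [:c:] + [:0, 1:] * (\<Sum>k\<le>N. smult (d k) (bessel_poly k))"
  shows "bessel_lin_coeff n m a 0 = c"
    and "bessel_lin_coeff n m a (Suc k) = (2 * real k + 1) * d k"
proof -
  define b where "b k = (case k of 0 \<Rightarrow> c | Suc j \<Rightarrow> (2 * real j + 1) * d j)" for k
  have "bessel_lin_coeff n m a = b"
  proof (rule bessel_lin_coeff_eqI)
    show "b k = 0" if "n + m < k" for k
      using that assms(1) by (auto simp: b_def zero split: nat.split)
    have nz: "2 * real j + 1 \<noteq> 0" for j by linarith
    have "exp_deriv (\<Sum>k\<le>Suc N. smult (b k) (bessel_poly k)) =
        [:c:] + [:0, 1:] * (\<Sum>k\<le>N. smult (d k) (bessel_poly k))"
      unfolding exp_deriv_bessel_sum by (simp add: b_def nz)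
    then show "pcompose (bessel_poly n) [:0, a:] * pcompose (bessel_poly m) [:0, 1 - a:] =
       (\<Sum>k\<le>n + m. smult (b k) (bessel_poly k))"
      unfolding assms(1) exp_deriv_inject[symmetric, of "_ * _"] using eq by (simp only:)
  qed
  then show "bessel_lin_coeff n m a 0 = c" "bessel_lin_coeff n m a (Suc k) = (2 * real k + 1) * d k"
    by (simp_all add: b_def)
qed

lemma scaled_exp_deriv_bessel_poly_Suc:
  "smult a (pcompose (exp_deriv (bessel_poly (Suc n))) [:0, a:]) =
     smult (a\<^sup>2 / (2 * real n + 1)) ([:0, 1:] * pcompose (bessel_poly n) [:0, a:])"
proof -
  have "pcompose [:0, 1:] [:0, a:] = smult a [:0, 1:]" by (simp add: pcompose_pCons)
  then show ?thesis
    by (simp only: exp_deriv_bessel_poly_Suc pcompose_smult pcompose_mult)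
       (simp add: power2_eq_square)
qed

context
  fixes n m :: nat and a :: real
begin

private lemma exp_deriv_bessel_product:
  "exp_deriv (pcompose (bessel_poly (Suc n)) [:0, a:] * pcompose (bessel_poly (Suc m)) [:0, 1 - a:]) =
     [:0:] + [:0, 1:] * (\<Sum>k\<le>n + Suc m.
       smult (a\<^sup>2 / (2 * real n + 1) * bessel_lin_coeff n (Suc m) a k +
              (1 - a)\<^sup>2 / (2 * real m + 1) * bessel_lin_coeff (Suc n) m a k) (bessel_poly k))"
proof -
  have "exp_deriv (pcompose (bessel_poly (Suc n)) [:0, a:] * pcompose (bessel_poly (Suc m)) [:0, 1 - a:]) =
      [:0, 1:] *
      (smult (a\<^sup>2 / (2 * real n + 1)) (pcompose (bessel_poly n) [:0, a:] * pcompose (bessel_poly (Suc m)) [:0, 1 - a:]) +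
       smult ((1 - a)\<^sup>2 / (2 * real m + 1)) (pcompose (bessel_poly (Suc n)) [:0, a:] * pcompose (bessel_poly m) [:0, 1 - a:]))"
    unfolding exp_deriv_scaled_mult scaled_exp_deriv_bessel_poly_Suc by (simp add: algebra_simps)
  also have "\<dots> = [:0, 1:] *
      (smult (a\<^sup>2 / (2 * real n + 1)) (\<Sum>k\<le>n + Suc m. smult (bessel_lin_coeff n (Suc m) a k) (bessel_poly k)) +
       smult ((1 - a)\<^sup>2 / (2 * real m + 1)) (\<Sum>k\<le>n + Suc m. smult (bessel_lin_coeff (Suc n) m a k) (bessel_poly k)))"
    by (subst (1 2) bessel_lin_coeff_expansion_le[where N = "n + Suc m"]) simp_all
  also have "\<dots> = [:0:] + [:0, 1:] * (\<Sum>k\<le>n + Suc m.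
       smult (a\<^sup>2 / (2 * real n + 1) * bessel_lin_coeff n (Suc m) a k +
              (1 - a)\<^sup>2 / (2 * real m + 1) * bessel_lin_coeff (Suc n) m a k) (bessel_poly k))"
    by (simp add: smult_sum_right smult_add_left sum.distrib del: sum.atMost_Suc)
  finally show ?thesis .
qed

lemma bessel_lin_coeff_Suc_Suc_0: "bessel_lin_coeff (Suc n) (Suc m) a 0 = 0"
  by (rule bessel_lin_coeff_by_exp_deriv(1)[OF _ _ exp_deriv_bessel_product])
     (simp_all add: bessel_lin_coeff_eq_0)

text \<open>
  The product rule splits the derivative of the product into two linearization problems, each with
  one index lowered by one.
\<close>
lemma bessel_lin_coeff_Suc_Suc_Suc:
  "bessel_lin_coeff (Suc n) (Suc m) a (Suc k) = (2 * real k + 1) *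
     (a\<^sup>2 / (2 * real n + 1) * bessel_lin_coeff n (Suc m) a k +
      (1 - a)\<^sup>2 / (2 * real m + 1) * bessel_lin_coeff (Suc n) m a k)"
  by (rule bessel_lin_coeff_by_exp_deriv(2)[OF _ _ exp_deriv_bessel_product])
     (simp_all add: bessel_lin_coeff_eq_0)

end

text \<open>
  Each step of the recursion lowers \<open>min n m\<close> by at most one, so the vanishing of \<open>\<beta>\<^sub>0\<close> for positive
  indices propagates.
\<close>
lemma bessel_lin_coeff_below_min:
  "k < min n m \<Longrightarrow> bessel_lin_coeff n m a k = 0"
proof (induction k arbitrary: n m)
  case 0
  then obtain n' m' where "n = Suc n'" "m = Suc m'"
    by (metis min_less_iff_conj gr0_implies_Suc)
  then show ?case by (simp add: bessel_lin_coeff_Suc_Suc_0)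
next
  case (Suc k)
  then obtain n' m' where nm: "n = Suc n'" "m = Suc m'"
    by (metis min_less_iff_conj Suc_lessE)
  with Suc.prems have "k < min n' m" "k < min n m'" by auto
  then show ?case using Suc.IH nm by (simp add: bessel_lin_coeff_Suc_Suc_Suc)
qed

section \<open>Connection coefficients: the case of index 0\<close>

text \<open>
  Put \<open>D = (q\<^sub>m\<^sub>+\<^sub>1 - 1)/u\<close> and \<open>T = exp_deriv\<close>. Computing \<open>T q\<^sub>m\<^sub>+\<^sub>1\<close> from \<open>q\<^sub>m\<^sub>+\<^sub>1 = 1 + u D\<close> and
  inserting it into the three-term relation gives
  \<open>(2m+3) (q\<^sub>m\<^sub>+\<^sub>2 - 1)/u = (2m+2) D + 1 + u T D\<close>. Since \<open>u T q\<^sub>j = (2j+1) (q\<^sub>j\<^sub>+\<^sub>1 - q\<^sub>j)\<close>, the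
  coefficient of \<open>q\<^sub>j\<close> on the right is \<open>(2m+1-2j) e\<^sub>j + (2j-1) e\<^sub>j\<^sub>-\<^sub>1\<close>, plus 1 for \<open>j = 0\<close>, and the
  first factor is positive as long as \<open>j \<le> m\<close>.
\<close>
lemma bessel_poly_Suc_minus_one_nonneg_expansion:
  "\<exists>e. (\<forall>j. 0 \<le> e j) \<and> (\<forall>j>m. e j = 0) \<and>
     bessel_poly (Suc m) = 1 + [:0, 1:] * (\<Sum>j\<le>m. smult (e j) (bessel_poly j))"
proof (induction m)
  case 0
  have "bessel_poly (Suc 0) = [:1, 1:]"
    by (simp add: bessel_poly_def one_pCons monom_0 monom_Suc)
  then show ?case
    by (intro exI[of _ "\<lambda>j. if j = 0 then 1 else 0"]) (simp add: bessel_poly_zero one_pCons)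
next
  case (Suc m)
  then obtain e where e: "\<And>j. 0 \<le> e j" "\<And>j. j > m \<Longrightarrow> e j = (0::real)"
    and q: "bessel_poly (Suc m) = 1 + [:0, 1:] * (\<Sum>j\<le>m. smult (e j) (bessel_poly j))"
    by blast
  define D where "D = (\<Sum>j\<le>m. smult (e j) (bessel_poly j))"
  \<comment> \<open>The next coefficients times \<open>2m + 3\<close>; both summands vanish beyond \<open>Suc m\<close>, and at
    \<open>j = Suc m\<close> the negative factor meets \<open>e j = 0\<close>.\<close>
  define f where "f j = (2 * real m + 1 - 2 * real j) * e j +
    (case j of 0 \<Rightarrow> 1 | Suc i \<Rightarrow> (2 * real i + 1) * e i)" for j
  have nz: "2 * real m + 3 \<noteq> 0" by linarith
  have D_Suc: "D = (\<Sum>j\<le>Suc m. smult (e j) (bessel_poly j))"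
    by (simp add: D_def e(2))
  have X_exp_deriv_D: "[:0, 1:] * exp_deriv D =
      (\<Sum>j\<le>m. smult ((2 * real j + 1) * e j) (bessel_poly (Suc j))) -
      (\<Sum>j\<le>Suc m. smult ((2 * real j + 1) * e j) (bessel_poly j))"
  proof -
    have "[:0, 1:] * exp_deriv D = (\<Sum>j\<le>m. smult (e j) ([:0, 1:] * exp_deriv (bessel_poly j)))"
      by (simp only: D_def exp_deriv_sum exp_deriv_smult sum_distrib_left mult_smult_right)
    also have "\<dots> = (\<Sum>j\<le>m. smult ((2 * real j + 1) * e j) (bessel_poly (Suc j)) -
        smult ((2 * real j + 1) * e j) (bessel_poly j))"
      by (simp only: X_mult_exp_deriv_bessel_poly) (simp add: smult_diff_right algebra_simps)
    finally show ?thesis by (simp add: sum_subtractf e(2))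
  qed
  have f_sum: "(\<Sum>j\<le>Suc m. smult (f j) (bessel_poly j)) =
      smult (2 * real m + 2) D + 1 + [:0, 1:] * exp_deriv D"
  proof -
    have "(\<Sum>j\<le>Suc m. smult (f j) (bessel_poly j)) =
        (\<Sum>j\<le>Suc m. smult ((2 * real m + 2) * e j) (bessel_poly j)) -
        (\<Sum>j\<le>Suc m. smult ((2 * real j + 1) * e j) (bessel_poly j)) +
        (\<Sum>j\<le>Suc m. smult (case j of 0 \<Rightarrow> 1 | Suc i \<Rightarrow> (2 * real i + 1) * e i) (bessel_poly j))"
      unfolding sum_subtractf[symmetric] sum.distrib[symmetric]
      by (rule sum.cong)
         (simp_all only: f_def smult_diff_left[symmetric] smult_add_left[symmetric] left_diff_distrib,
          simp add: algebra_simps)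
    also have "(\<Sum>j\<le>Suc m. smult (case j of 0 \<Rightarrow> 1 | Suc i \<Rightarrow> (2 * real i + 1) * e i) (bessel_poly j)) =
        1 + (\<Sum>j\<le>m. smult ((2 * real j + 1) * e j) (bessel_poly (Suc j)))"
      by (subst sum.atMost_Suc_shift) (simp add: bessel_poly_zero)
    also have "(\<Sum>j\<le>Suc m. smult ((2 * real m + 2) * e j) (bessel_poly j)) = smult (2 * real m + 2) D"
      unfolding D_Suc smult_sum_right smult_smult ..
    finally show ?thesis unfolding X_exp_deriv_D by (simp add: algebra_simps)
  qed
  have "exp_deriv (1 + [:0, 1:] * D) = 1 - D + [:0, 1:] * exp_deriv D"
    by (simp add: exp_deriv_def pderiv_add pderiv_pCons algebra_simps)
  then have "[:0, 1:] * (1 - D + [:0, 1:] * exp_deriv D) =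
      smult (2 * real m + 3) (bessel_poly (Suc (Suc m)) - (1 + [:0, 1:] * D))"
    using X_mult_exp_deriv_bessel_poly[of "Suc m"] unfolding q D_def[symmetric]
    by (simp add: add.commute)
  moreover have "[:0, 1:] * (\<Sum>j\<le>Suc m. smult (f j) (bessel_poly j)) =
      [:0, 1:] * (1 - D + [:0, 1:] * exp_deriv D) + smult (2 * real m + 3) ([:0, 1:] * D)"
  proof -
    have "smult (2 * real m + 2) D = smult (2 * real m + 3) D - D"
      using smult_diff_left[of "2 * real m + 3" 1 D] by (simp add: add.commute)
    then show ?thesis
      unfolding f_sum mult_smult_right[symmetric] distrib_left[symmetric]
      by (simp only: diff_conv_add_uminus ac_simps)
  qed
  ultimately have "[:0, 1:] * (\<Sum>j\<le>Suc m. smult (f j) (bessel_poly j)) =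
      smult (2 * real m + 3) (bessel_poly (Suc (Suc m)) - (1 + [:0, 1:] * D)) +
      smult (2 * real m + 3) ([:0, 1:] * D)"
    by (simp only:)
  also have "\<dots> = smult (2 * real m + 3) (bessel_poly (Suc (Suc m))) - smult (2 * real m + 3) 1"
    unfolding smult_diff_right smult_add_right diff_diff_add[symmetric] by (rule diff_add_cancel)
  finally have "smult (2 * real m + 3) (bessel_poly (Suc (Suc m))) =
      smult (2 * real m + 3) 1 + [:0, 1:] * (\<Sum>j\<le>Suc m. smult (f j) (bessel_poly j))"
    by (simp only: add_diff_cancel_left' diff_add_cancel add_diff_eq ac_simps)
  then have "smult (1 / (2 * real m + 3)) (smult (2 * real m + 3) (bessel_poly (Suc (Suc m)))) =
      smult (1 / (2 * real m + 3)) (smult (2 * real m + 3) 1) +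
      [:0, 1:] * smult (1 / (2 * real m + 3)) (\<Sum>j\<le>Suc m. smult (f j) (bessel_poly j))"
    by (simp only: smult_add_right mult_smult_right)
  moreover have "smult (1 / (2 * real m + 3)) (smult (2 * real m + 3) p) = p" for p
    using nz by simp
  moreover have "smult (1 / (2 * real m + 3)) (\<Sum>j\<le>Suc m. smult (f j) (bessel_poly j)) =
      (\<Sum>j\<le>Suc m. smult (f j / (2 * real m + 3)) (bessel_poly j))"
    by (simp add: smult_sum_right del: sum.atMost_Suc)
  ultimately have expansion: "bessel_poly (Suc (Suc m)) =
      1 + [:0, 1:] * (\<Sum>j\<le>Suc m. smult (f j / (2 * real m + 3)) (bessel_poly j))"
    by (simp only:)
  have f_zero: "f j = 0" if "j > Suc m" for j
    using that by (auto simp: f_def e(2) split: nat.split)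
  have "0 \<le> f j" for j
  proof (cases "j \<le> m")
    case True
    then show ?thesis using e(1) by (auto simp: f_def split: nat.split)
  next
    case False
    then show ?thesis using e by (auto simp: f_def split: nat.split)
  qed
  then show ?case using expansion f_zero
    by (intro exI[of _ "\<lambda>j. f j / (2 * real m + 3)"]) simp
qed

lemma bessel_lin_coeff_0_0: "bessel_lin_coeff 0 0 a k = (if k = 0 then 1 else 0)"
proof -
  have "bessel_lin_coeff 0 0 a = (\<lambda>k. if k = 0 then 1 else 0)"
    by (rule bessel_lin_coeff_eqI) (simp_all add: bessel_poly_zero pcompose_1)
  then show ?thesis by simp
qed

text \<open>
  With first index 0 the factor \<open>e\<^sup>-\<^sup>a\<^sup>u\<close> differentiates into a multiple of itself, which leaves
  \<open>a q\<^sub>m\<^sub>+\<^sub>1((1-a)u)\<close>. Its constant term gives \<open>\<beta>\<^sub>0 = a\<close>, and the rest is divisible by \<open>u\<close>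
  with a quotient that is a nonnegative combination of the \<open>q\<^sub>j((1-a)u)\<close> with \<open>j \<le> m\<close>.
\<close>
lemma bessel_lin_coeff_0_Suc:
  obtains e where "\<And>j. (0::real) \<le> e j"
    and "\<And>a. bessel_lin_coeff 0 (Suc m) a 0 = a"
    and "\<And>a k. bessel_lin_coeff 0 (Suc m) a (Suc k) = (2 * real k + 1) *
       ((1 - a)\<^sup>2 / (2 * real m + 1) * bessel_lin_coeff 0 m a k +
        a * (1 - a) * (\<Sum>j\<le>m. e j * bessel_lin_coeff 0 j a k))"
proof -
  obtain e where e: "\<And>j. (0::real) \<le> e j"
    and q: "bessel_poly (Suc m) = 1 + [:0, 1:] * (\<Sum>j\<le>m. smult (e j) (bessel_poly j))"
    using bessel_poly_Suc_minus_one_nonneg_expansion[of m] by blast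
  define d where "d a k = (1 - a)\<^sup>2 / (2 * real m + 1) * bessel_lin_coeff 0 m a k +
        a * (1 - a) * (\<Sum>j\<le>m. e j * bessel_lin_coeff 0 j a k)" for a k
  have scaled: "pcompose (bessel_poly j) [:0, 1 - a:] =
      (\<Sum>k\<le>m. smult (bessel_lin_coeff 0 j a k) (bessel_poly k))" if "j \<le> m" for j a
    using bessel_lin_coeff_expansion_le[of 0 j m a] that by (simp add: bessel_poly_zero pcompose_1)
  have eq: "exp_deriv (pcompose (bessel_poly 0) [:0, a:] * pcompose (bessel_poly (Suc m)) [:0, 1 - a:]) =
      [:a:] + [:0, 1:] * (\<Sum>k\<le>m. smult (d a k) (bessel_poly k))" for a
  proof -
    have X: "pcompose [:0, 1:] [:0, 1 - a:] = smult (1 - a) [:0, 1:]" by (simp add: pcompose_pCons)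
    have "pcompose (bessel_poly (Suc m)) [:0, 1 - a:] =
        1 + smult (1 - a) ([:0, 1:] * (\<Sum>j\<le>m. smult (e j) (pcompose (bessel_poly j) [:0, 1 - a:])))"
      unfolding q
      by (simp only: pcompose_add pcompose_1 pcompose_mult pcompose_sum pcompose_smult X mult_smult_left)
    also have "(\<Sum>j\<le>m. smult (e j) (pcompose (bessel_poly j) [:0, 1 - a:])) =
        (\<Sum>j\<le>m. \<Sum>k\<le>m. smult (e j * bessel_lin_coeff 0 j a k) (bessel_poly k))"
      by (rule sum.cong) (simp_all add: scaled smult_sum_right)
    also have "\<dots> = (\<Sum>k\<le>m. smult (\<Sum>j\<le>m. e j * bessel_lin_coeff 0 j a k) (bessel_poly k))"
      by (subst sum.swap) (simp add: smult_sum)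
    finally have 1: "pcompose (bessel_poly (Suc m)) [:0, 1 - a:] = 1 + smult (1 - a)
      ([:0, 1:] * (\<Sum>k\<le>m. smult (\<Sum>j\<le>m. e j * bessel_lin_coeff 0 j a k) (bessel_poly k)))" .
    have "exp_deriv (pcompose (bessel_poly 0) [:0, a:] * pcompose (bessel_poly (Suc m)) [:0, 1 - a:]) =
        smult a (pcompose (bessel_poly (Suc m)) [:0, 1 - a:]) +
        smult ((1 - a)\<^sup>2 / (2 * real m + 1)) ([:0, 1:] * pcompose (bessel_poly m) [:0, 1 - a:])"
      unfolding exp_deriv_scaled_mult scaled_exp_deriv_bessel_poly_Suc exp_deriv_bessel_poly_0
      by (simp add: bessel_poly_zero pcompose_1)
    also have "\<dots> = [:a:] + [:0, 1:] *
       (smult (a * (1 - a)) (\<Sum>k\<le>m. smult (\<Sum>j\<le>m. e j * bessel_lin_coeff 0 j a k) (bessel_poly k)) +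
        smult ((1 - a)\<^sup>2 / (2 * real m + 1)) (\<Sum>k\<le>m. smult (bessel_lin_coeff 0 m a k) (bessel_poly k)))"
      unfolding 1 scaled[OF order_refl] by (simp add: smult_add_right one_pCons algebra_simps)
    also have "\<dots> = [:a:] + [:0, 1:] * (\<Sum>k\<le>m. smult (d a k) (bessel_poly k))"
      by (simp add: d_def smult_sum_right smult_add_left sum.distrib add.commute)
    finally show ?thesis .
  qed
  have zero: "d a k = 0" if "m < k" for a k
    using that by (simp add: d_def bessel_lin_coeff_eq_0)
  show thesis
  proof (rule that[OF e])
    show "bessel_lin_coeff 0 (Suc m) a 0 = a" for a
      by (rule bessel_lin_coeff_by_exp_deriv(1)[OF _ zero eq]) simp_all
    show "bessel_lin_coeff 0 (Suc m) a (Suc k) = (2 * real k + 1) *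
       ((1 - a)\<^sup>2 / (2 * real m + 1) * bessel_lin_coeff 0 m a k +
        a * (1 - a) * (\<Sum>j\<le>m. e j * bessel_lin_coeff 0 j a k))" for a k
      unfolding d_def[symmetric] by (rule bessel_lin_coeff_by_exp_deriv(2)[OF _ zero eq]) simp_all
  qed
qed

lemma bessel_lin_coeff_0_Suc_0: "bessel_lin_coeff 0 (Suc m) a 0 = a"
  by (rule bessel_lin_coeff_0_Suc[of m])

lemma bessel_lin_coeff_0_nonneg:
  assumes "0 \<le> a" "a \<le> 1"
  shows "0 \<le> bessel_lin_coeff 0 m a k"
proof (induction k arbitrary: m)
  case 0
  show ?case
  proof (cases m)
    case (Suc m')
    then show ?thesis using assms by (simp add: bessel_lin_coeff_0_Suc_0)
  qed (simp add: bessel_lin_coeff_0_0)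
next
  case (Suc k)
  show ?case
  proof (cases m)
    case (Suc m')
    obtain e where "\<And>j. (0::real) \<le> e j"
      and "\<And>a. bessel_lin_coeff 0 (Suc m') a 0 = a"
      and "\<And>a k. bessel_lin_coeff 0 (Suc m') a (Suc k) = (2 * real k + 1) *
       ((1 - a)\<^sup>2 / (2 * real m' + 1) * bessel_lin_coeff 0 m' a k +
        a * (1 - a) * (\<Sum>j\<le>m'. e j * bessel_lin_coeff 0 j a k))"
      by (rule bessel_lin_coeff_0_Suc[of m']) (rule that)
    then show ?thesis using Suc.IH assms \<open>m = Suc m'\<close> by (simp add: sum_nonneg)
  qed (simp add: bessel_lin_coeff_0_0)
qed

text \<open>
  The term \<open>(1-a)\<^sup>2/(2m+1) \<beta>\<^sub>k\<close> alone keeps the coefficient positive along the diagonal from \<open>(m, k)\<close>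
  down to \<open>(m - k, 0)\<close>, where the value is 1 or \<open>a\<close>.
\<close>
lemma bessel_lin_coeff_0_pos:
  assumes "0 < a" "a < 1" "k \<le> m"
  shows "0 < bessel_lin_coeff 0 m a k"
  using assms(3)
proof (induction k arbitrary: m)
  case 0
  show ?case
  proof (cases m)
    case (Suc m')
    then show ?thesis using assms by (simp add: bessel_lin_coeff_0_Suc_0)
  qed (simp add: bessel_lin_coeff_0_0)
next
  case (Suc k)
  then obtain m' where m: "m = Suc m'" "k \<le> m'" by (cases m) auto
  obtain e where e: "\<And>j. (0::real) \<le> e j"
    and "\<And>a. bessel_lin_coeff 0 (Suc m') a 0 = a"
    and eq: "\<And>a k. bessel_lin_coeff 0 (Suc m') a (Suc k) = (2 * real k + 1) *
     ((1 - a)\<^sup>2 / (2 * real m' + 1) * bessel_lin_coeff 0 m' a k +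
      a * (1 - a) * (\<Sum>j\<le>m'. e j * bessel_lin_coeff 0 j a k))"
    by (rule bessel_lin_coeff_0_Suc[of m']) (rule that)
  have "0 < (1 - a)\<^sup>2 / (2 * real m' + 1) * bessel_lin_coeff 0 m' a k"
    using Suc.IH[OF m(2)] assms by simp
  moreover have "0 \<le> a * (1 - a) * (\<Sum>j\<le>m'. e j * bessel_lin_coeff 0 j a k)"
    using e assms by (simp add: sum_nonneg bessel_lin_coeff_0_nonneg)
  moreover have "0 < 2 * real k + 1" by linarith
  ultimately show ?case unfolding m(1) eq by (intro mult_pos_pos[of "2 * real k + 1"] add_pos_nonneg[of "(1 - a)\<^sup>2 / (2 * real m' + 1) * bessel_lin_coeff 0 m' a k"])
qed

section \<open>Positivity\<close>

text \<open>
  The recursion moves \<open>(n, m, k)\<close> with \<open>n \<le> k < m\<close> to \<open>(n-1, m, k-1)\<close>, in the same range, and to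
  \<open>(n, m-1, k-1)\<close>, which either is in the range as well or has \<open>k-1 < min n (m-1)\<close> and contributes
  0. The first branch ends at \<open>n = 0\<close> and carries strict positivity, since its weight contains
  \<open>a\<^sup>2\<close>. At the endpoints strictness is lost: for \<open>a = 0\<close> the product is
  \<open>q\<^sub>m\<close>, and for \<open>a = 1\<close> it is \<open>q\<^sub>n\<close>.
\<close>
theorem corollary3:
  fixes n m :: nat and a :: real
  assumes "0 \<le> a" and "a \<le> 1" and "n < m"
  shows "\<forall>k. n \<le> k \<and> k < m \<longrightarrow>
           0 \<le> bessel_lin_coeff n m a k \<and>
           (0 < a \<and> a < 1 \<longrightarrow> 0 < bessel_lin_coeff n m a k)"
proof (intro allI impI)
  fix k assume "n \<le> k \<and> k < m"
  then have "n \<le> k" "k < m" by simp_all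
  then show "0 \<le> bessel_lin_coeff n m a k \<and>
      (0 < a \<and> a < 1 \<longrightarrow> 0 < bessel_lin_coeff n m a k)"
  proof (induction k arbitrary: n m)
    case 0
    then show ?case using assms by (simp add: bessel_lin_coeff_0_nonneg bessel_lin_coeff_0_pos)
  next
    case (Suc k)
    show ?case
    proof (cases n)
      case 0
      then show ?thesis using assms Suc.prems
        by (simp add: bessel_lin_coeff_0_nonneg bessel_lin_coeff_0_pos)
    next
      case n: (Suc n')
      obtain m' where m: "m = Suc m'" using Suc.prems by (cases m) auto
      have first: "0 \<le> bessel_lin_coeff n' (Suc m') a k"
        "0 < a \<and> a < 1 \<longrightarrow> 0 < bessel_lin_coeff n' (Suc m') a k"
        using Suc.IH[of n' "Suc m'"] Suc.prems n m by simp_all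
      have second: "0 \<le> bessel_lin_coeff (Suc n') m' a k"
      proof (cases "Suc n' \<le> k")
        case True
        then show ?thesis using Suc.IH[of "Suc n'" m'] Suc.prems m by simp
      next
        case False
        then show ?thesis using Suc.prems m by (simp add: bessel_lin_coeff_below_min)
      qed
      have k: "0 < 2 * real k + 1" by linarith
      have weighted: "0 \<le> a\<^sup>2 / (2 * real n' + 1) * bessel_lin_coeff n' (Suc m') a k"
        "0 \<le> (1 - a)\<^sup>2 / (2 * real m' + 1) * bessel_lin_coeff (Suc n') m' a k"
        "0 < a \<and> a < 1 \<longrightarrow> 0 < a\<^sup>2 / (2 * real n' + 1) * bessel_lin_coeff n' (Suc m') a k"
        using first second by simp_all
      show ?thesis unfolding n m bessel_lin_coeff_Suc_Suc_Suc
        by (intro conjI impI mult_nonneg_nonneg[OF less_imp_le[OF k]] mult_pos_pos[OF k]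
            add_nonneg_nonneg add_pos_nonneg weighted(1,2) weighted(3)[THEN mp]) simp_all
    qed
  qed
qed

end
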